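(* Let $B=\bigcup_{i\in\mathbb{N}}B_i$ be a filtered ring with associated graded ring $\mathrm{gr}(B)=\bigoplus_{i\in\mathbb{N}}B_i/B_{i-1}$, and let $M=\bigcup_{i\in\mathbb{N}}M_i$ be a filtered $B$-module with associated graded $\mathrm{gr}(B)$-module $\mathrm{gr}(M)=\bigoplus_{i\in\mathbb{N}}M_i/M_{i-1}$. Suppose that the $\mathrm{gr}(B)$-module $\mathrm{gr}(M)$ is a Euclidean module with Euclidean function $\deg_{\mathrm{gr}(M)}$. Then: (1) The $B$-module $M$ is a Euclidean module with Euclidean function $\deg_M$. Furthermore, for all nonzero $u,v\in M$ with $\deg_M(u)\ge\deg_M(v)$ there exist $q\in B$ and $r\in M$ such that $u=qv+r$, $\deg_B(q)=\deg_M(u)-\deg_M(v)$ and $\deg_M(r)<\deg_M(v)$. (2) Every submodule of the $B$-module $M$ is principal (generated by one element). (3) Let $N$ be a nonzero submodule of $M$. Every element of the non-empty set $\mathcal{G}(N):=\{n\in N:\deg_M(n)=l(N)\}$, where $l(N):=\min\{\deg_M(n'):0\neq n'\in N\}$, generates the $B$-module $N$. Similarly, every element of the non-empty set $\mathcal{G}(\mathrm{gr}(N)):=\{\nu\in\mathrm{gr}(N):\deg_{\mathrm{gr}(M)}(\nu)=l(\mathrm{gr}(N))\}$, where $l(\mathrm{gr}(N)):=\min\{\deg_{\mathrm{gr}(M)}(\nu'):0\neq\nu'\in\mathrm{gr}(N)\}$, generates the $\mathrm{gr}(B)$-module $\mathrm{gr}(N)$. Moreover $l(N)=l(\mathrm{gr}(N))$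 and $\mathrm{gr}(\mathcal{G}(N))=\mathcal{G}(\mathrm{gr}(N))\subseteq\mathcal{UA}(\mathrm{gr}(N))$.
   Context: Rings are unital, modules are left modules, $\mathbb{N}=\{0,1,2,\ldots\}$. Filtrations are ascending and indexed by $\mathbb{N}$: $B_0\subseteq B_1\subseteq\cdots$, $1\in B_0$, $B_iB_j\subseteq B_{i+j}$, $B_iM_j\subseteq M_{i+j}$, $B_{-1}=0$, $M_{-1}=0$. For nonzero $m\in M$, $\deg_M(m)$ is the unique $i$ with $m\in M_i\setminus M_{i-1}$, and $\mathrm{gr}(m):=m+M_{i-1}\in M_i/M_{i-1}$; similarly $\deg_B$ and $\mathrm{gr}$ on $B$. For a nonzero $\sum_im_i\in\mathrm{gr}(M)$ with $m_i\in M_i/M_{i-1}$, $\deg_{\mathrm{gr}(M)}(\sum m_i):=\max\{i:m_i\neq0\}$. By convention the degree of $0$ is $-\infty$. For a submodule $N\subseteq M$, $\mathrm{gr}(N)=\bigoplus_i(N\cap M_i)/(N\cap M_{i-1})\subseteq\mathrm{gr}(M)$. A module $E$ over a ring $C$ is Euclidean with Euclidean function $d:E\setminus\{0\}\to\mathbb{N}$ if for any nonzero $u,v\in E$ there are $q\in C$, $r\in E$ with $u=qv+r$ and either $r=0$ or $d(r)<d(v)$. For a graded module $E=\bigoplus E_i$ over a graded ring $C=\bigoplus C_i$, an element $m=\sum m_i$ ($m_i\in E_i$) is a uni-annihilator element if $\mathrm{ann}_{C_0}(m)=\mathrm{ann}_{C_0}(m_i)$ for all nonzero components $m_i$; $\mathcal{UA}(E)$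 is the set of such elements. *)

theory Defs
  imports "HOL-Algebra.Product_Groups" "HOL-Algebra.Module" "HOL-Algebra.AbelCoset"
begin

section \<open>Left modules over noncommutative rings\<close>

text \<open>The axioms of the library locale \<open>module\<close>, which requires the ring to be commutative.\<close>

locale left_module = R?: ring R + M?: abelian_group M
  for R :: "('a, 'r) ring_scheme" (structure) and M :: "('a, 'b, 'm) module_scheme" (structure) +
  assumes smult_closed [simp, intro]:
      "\<lbrakk>a \<in> carrier R; x \<in> carrier M\<rbrakk> \<Longrightarrow> a \<odot>\<^bsub>M\<^esub> x \<in> carrier M"
    and smult_l_distr:
      "\<lbrakk>a \<in> carrier R; b \<in> carrier R; x \<in> carrier M\<rbrakk> \<Longrightarrow>
      (a \<oplus> b) \<odot>\<^bsub>M\<^esub> x = a \<odot>\<^bsub>M\<^esub> x \<oplus>\<^bsub>M\<^esub> b \<odot>\<^bsub>M\<^esub> x"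
    and smult_r_distr:
      "\<lbrakk>a \<in> carrier R; x \<in> carrier M; y \<in> carrier M\<rbrakk> \<Longrightarrow>
      a \<odot>\<^bsub>M\<^esub> (x \<oplus>\<^bsub>M\<^esub> y) = a \<odot>\<^bsub>M\<^esub> x \<oplus>\<^bsub>M\<^esub> a \<odot>\<^bsub>M\<^esub> y"
    and smult_assoc1:
      "\<lbrakk>a \<in> carrier R; b \<in> carrier R; x \<in> carrier M\<rbrakk> \<Longrightarrow>
      (a \<otimes> b) \<odot>\<^bsub>M\<^esub> x = a \<odot>\<^bsub>M\<^esub> (b \<odot>\<^bsub>M\<^esub> x)"
    and smult_one [simp]:
      "x \<in> carrier M \<Longrightarrow> \<one> \<odot>\<^bsub>M\<^esub> x = x"

definition cyclic_submodule ::
  "('a, 'r) ring_scheme \<Rightarrow> ('a, 'b, 'm) module_scheme \<Rightarrow> 'b \<Rightarrow> 'b set"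
  where "cyclic_submodule R M x = (\<lambda>a. a \<odot>\<^bsub>M\<^esub> x) ` carrier R"

definition euclidean_module ::
  "('a, 'r) ring_scheme \<Rightarrow> ('a, 'b, 'm) module_scheme \<Rightarrow> ('b \<Rightarrow> nat) \<Rightarrow> bool"
  where "euclidean_module C E d \<longleftrightarrow> left_module C E \<and>
    (\<forall>u \<in> carrier E - {\<zero>\<^bsub>E\<^esub>}. \<forall>v \<in> carrier E - {\<zero>\<^bsub>E\<^esub>}.
      \<exists>q \<in> carrier C. \<exists>r \<in> carrier E.
        u = q \<odot>\<^bsub>E\<^esub> v \<oplus>\<^bsub>E\<^esub> r \<and> (r = \<zero>\<^bsub>E\<^esub> \<or> d r < d v))"

section \<open>Filtrations\<close>

text \<open>The step preceding the \<open>i\<close>-th one, with the convention that the step with index \<open>-1\<close> is zero.\<close>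

definition pred_step :: "('a, 'c) ring_scheme \<Rightarrow> (nat \<Rightarrow> 'a set) \<Rightarrow> nat \<Rightarrow> 'a set"
  where "pred_step A F i = (case i of 0 \<Rightarrow> {\<zero>\<^bsub>A\<^esub>} | Suc j \<Rightarrow> F j)"

locale filtration = abelian_group A
  for A :: "('a, 'c) ring_scheme" (structure) and F :: "nat \<Rightarrow> 'a set" +
  assumes step_subgroup: "additive_subgroup (F i) A"
    and step_mono: "F i \<subseteq> F (Suc i)"
    and exhaustive: "carrier A = (\<Union>i. F i)"

locale filtered_ring = ring B + filtration B FB
  for B :: "('a, 'r) ring_scheme" (structure) and FB :: "nat \<Rightarrow> 'a set" +
  assumes one_step: "\<one> \<in> FB 0"
    and mult_step: "\<lbrakk>a \<in> FB i; b \<in> FB j\<rbrakk> \<Longrightarrow> a \<otimes> b \<in> FB (i + j)"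

locale filtered_module =
  left_module B M + FB: filtered_ring B FB + FM: filtration M FM
  for B :: "('a, 'r) ring_scheme" (structure) and FB :: "nat \<Rightarrow> 'a set"
    and M :: "('a, 'b, 'm) module_scheme" (structure) and FM :: "nat \<Rightarrow> 'b set" +
  assumes smult_step: "\<lbrakk>a \<in> FB i; x \<in> FM j\<rbrakk> \<Longrightarrow> a \<odot>\<^bsub>M\<^esub> x \<in> FM (i + j)"

text \<open>Degrees are natural numbers and are meaningful for nonzero elements only.  The convention
  that zero has degree \<open>-\<infinity>\<close> is spelled out where it is used:
  ``the degree of \<open>r\<close> is less than \<open>k\<close>'' is written as \<open>r = \<zero> \<or> deg r < k\<close>, and
  ``the degree of \<open>q\<close> is (the natural number) \<open>k\<close>'' as \<open>q \<noteq> \<zero> \<and> deg q = k\<close>.\<close>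

definition filt_deg :: "('a, 'c) ring_scheme \<Rightarrow> (nat \<Rightarrow> 'a set) \<Rightarrow> 'a \<Rightarrow> nat"
  where "filt_deg A F x = (THE i. x \<in> F i - pred_step A F i)"

section \<open>Associated graded objects\<close>

text \<open>An element of the associated graded group is the sequence of its homogeneous components;
  the \<open>i\<close>-th component is a coset of \<open>pred_step A F i\<close> in \<open>F i\<close>.\<close>

definition gr_piece :: "('a, 'c) ring_scheme \<Rightarrow> (nat \<Rightarrow> 'a set) \<Rightarrow> nat \<Rightarrow> 'a set monoid"
  where "gr_piece A F i = (A\<lparr>carrier := F i\<rparr>) A_Mod (pred_step A F i)"

definition gr_group :: "('a, 'c) ring_scheme \<Rightarrow> (nat \<Rightarrow> 'a set) \<Rightarrow> (nat \<Rightarrow> 'a set) monoid"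
  where "gr_group A F = sum_group UNIV (gr_piece A F)"

text \<open>The product on associated graded objects induced by a filtered biadditive operation \<open>p\<close>
  with values in \<open>A\<close>.  The product of the class of \<open>x\<close> in degree \<open>i\<close> and the class of \<open>y\<close> in
  degree \<open>j\<close> is the class of \<open>p x y\<close> in degree \<open>i + j\<close>; the union below is over
  representatives \<open>x\<close>, \<open>y\<close>, all of which give the same coset
  (this is the same device as in the library's \<open>rcoset_mult\<close>).\<close>

definition gr_mult :: "('a, 'c) ring_scheme \<Rightarrow> (nat \<Rightarrow> 'a set) \<Rightarrow> ('b \<Rightarrow> 'a \<Rightarrow> 'a) \<Rightarrow>
    (nat \<Rightarrow> 'b set) \<Rightarrow> (nat \<Rightarrow> 'a set) \<Rightarrow> (nat \<Rightarrow> 'a set)"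
  where "gr_mult A F p f g = (\<lambda>k. finprod (gr_piece A F k)
    (\<lambda>i. \<Union>x \<in> f i. \<Union>y \<in> g (k - i). pred_step A F k +>\<^bsub>A\<^esub> p x y) {..k})"

text \<open>The homogeneous element of degree \<open>i\<close> given by the class of \<open>x\<close>.\<close>

definition gr_homog :: "('a, 'c) ring_scheme \<Rightarrow> (nat \<Rightarrow> 'a set) \<Rightarrow> nat \<Rightarrow> 'a \<Rightarrow> (nat \<Rightarrow> 'a set)"
  where "gr_homog A F i x =
    (\<lambda>j. if j = i then pred_step A F j +>\<^bsub>A\<^esub> x else pred_step A F j)"

definition gr_elt :: "('a, 'c) ring_scheme \<Rightarrow> (nat \<Rightarrow> 'a set) \<Rightarrow> 'a \<Rightarrow> (nat \<Rightarrow> 'a set)"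
  where "gr_elt A F x = gr_homog A F (filt_deg A F x) x"

definition gr_ring :: "('a, 'r) ring_scheme \<Rightarrow> (nat \<Rightarrow> 'a set) \<Rightarrow> (nat \<Rightarrow> 'a set) ring"
  where "gr_ring B FB =
    \<lparr>carrier = carrier (gr_group B FB), monoid.mult = gr_mult B FB (\<lambda>x y. x \<otimes>\<^bsub>B\<^esub> y),
     one = gr_homog B FB 0 \<one>\<^bsub>B\<^esub>,
     zero = \<one>\<^bsub>gr_group B FB\<^esub>, add = (\<lambda>f g. f \<otimes>\<^bsub>gr_group B FB\<^esub> g)\<rparr>"

text \<open>The fields \<open>mult\<close> and \<open>one\<close> are part of the library's record type of modules,
  but play no role for modules.\<close>

definition gr_module ::
  "('a, 'b, 'm) module_scheme \<Rightarrow> (nat \<Rightarrow> 'b set) \<Rightarrow> (nat \<Rightarrow> 'a set, nat \<Rightarrow> 'b set) module"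
  where "gr_module M FM =
    \<lparr>carrier = carrier (gr_group M FM), monoid.mult = undefined, one = undefined,
     zero = \<one>\<^bsub>gr_group M FM\<^esub>, add = (\<lambda>f g. f \<otimes>\<^bsub>gr_group M FM\<^esub> g),
     smult = gr_mult M FM (\<lambda>a x. a \<odot>\<^bsub>M\<^esub> x)\<rparr>"

text \<open>The graded submodule of \<^term>\<open>gr_module M FM\<close> of a submodule \<open>N\<close>: its piece of degree \<open>i\<close> is
  the image of the quotient of \<open>N \<inter> FM i\<close> by \<open>N \<inter> pred_step M FM i\<close> under the
  canonical embedding into the piece of degree \<open>i\<close> of \<^term>\<open>gr_module M FM\<close>.\<close>

definition gr_submodule ::
  "('a, 'b, 'm) module_scheme \<Rightarrow> (nat \<Rightarrow> 'b set) \<Rightarrow> 'b set \<Rightarrow> (nat \<Rightarrow> 'b set) set"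
  where "gr_submodule M FM N = {f \<in> carrier (gr_module M FM).
    \<forall>i. f i \<in> (\<lambda>x. pred_step M FM i +>\<^bsub>M\<^esub> x) ` (N \<inter> FM i)}"

section \<open>Graded modules whose elements are given by their sequences of components\<close>

definition graded_deg :: "('a, nat \<Rightarrow> 'b, 'm) module_scheme \<Rightarrow> (nat \<Rightarrow> 'b) \<Rightarrow> nat"
  where "graded_deg E f = Max {i. f i \<noteq> \<zero>\<^bsub>E\<^esub> i}"

definition component :: "('a, nat \<Rightarrow> 'b, 'm) module_scheme \<Rightarrow> (nat \<Rightarrow> 'b) \<Rightarrow> nat \<Rightarrow> (nat \<Rightarrow> 'b)"
  where "component E f i = (\<lambda>j. if j = i then f j else \<zero>\<^bsub>E\<^esub> j)"

definition degree_zero_part :: "(nat \<Rightarrow> 'a, 'r) ring_scheme \<Rightarrow> (nat \<Rightarrow> 'a) set"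
  where "degree_zero_part C = {c \<in> carrier C. \<forall>i. i \<noteq> 0 \<longrightarrow> c i = \<zero>\<^bsub>C\<^esub> i}"

definition ann :: "('a, 'b, 'm) module_scheme \<Rightarrow> 'a set \<Rightarrow> 'b \<Rightarrow> 'a set"
  where "ann E S x = {c \<in> S. c \<odot>\<^bsub>E\<^esub> x = \<zero>\<^bsub>E\<^esub>}"

definition uni_annihilators ::
  "(nat \<Rightarrow> 'a, 'r) ring_scheme \<Rightarrow> (nat \<Rightarrow> 'a, nat \<Rightarrow> 'b, 'm) module_scheme \<Rightarrow> (nat \<Rightarrow> 'b) set"
  where "uni_annihilators C E = {f \<in> carrier E. \<forall>i. component E f i \<noteq> \<zero>\<^bsub>E\<^esub> \<longrightarrow>
    ann E (degree_zero_part C) f = ann E (degree_zero_part C) (component E f i)}"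

section \<open>Elements of minimal degree\<close>

text \<open>In both definitions \<open>d\<close> is a degree function on the nonzero elements of \<open>E\<close>.\<close>

definition min_deg :: "('a, 'c) ring_scheme \<Rightarrow> ('a \<Rightarrow> nat) \<Rightarrow> 'a set \<Rightarrow> nat"
  where "min_deg E d N = (LEAST k. \<exists>x \<in> N. x \<noteq> \<zero>\<^bsub>E\<^esub> \<and> k = d x)"

definition min_deg_elts :: "('a, 'c) ring_scheme \<Rightarrow> ('a \<Rightarrow> nat) \<Rightarrow> 'a set \<Rightarrow> 'a set"
  where "min_deg_elts E d N = {x \<in> N. x \<noteq> \<zero>\<^bsub>E\<^esub> \<and> d x = min_deg E d N}"

section \<open>The associated graded ring and module satisfy the ring and module axioms\<close>

context filtration
begin

lemma pred_step_subgroup: "additive_subgroup (pred_step A F i) A"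
proof (cases i)
  case 0
  have "additive_subgroup {\<zero>} A"
    by (intro additive_subgroup.intro subgroup.intro) (auto simp: add.inv_one)
  then show ?thesis using 0 by (simp add: pred_step_def)
next
  case (Suc j) then show ?thesis by (simp add: pred_step_def step_subgroup)
qed

lemma pred_step_subset: "pred_step A F i \<subseteq> F i"
  using additive_subgroup.zero_closed[OF step_subgroup] step_mono
  by (auto simp: pred_step_def split: nat.split)

lemma step_carrier: "x \<in> F i \<Longrightarrow> x \<in> carrier A"
  using exhaustive by auto

lemma step_group: "abelian_group (A\<lparr>carrier := F i\<rparr>)"
proof -
  interpret S: additive_subgroup "F i" A by (rule step_subgroup)
  have "group (add_monoid A\<lparr>carrier := F i\<rparr>)"
    using add.subgroup_imp_group[OF S.a_subgroup] by simp
  then show ?thesis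
    by (intro abelian_groupI)
       (auto simp: S.a_closed S.zero_closed a_ac step_carrier
          dest: S.a_inv_closed intro!: bexI[of _ "\<ominus> _"] l_neg r_neg)
qed

lemma pred_abelian_subgroup: "abelian_subgroup (pred_step A F i) (A\<lparr>carrier := F i\<rparr>)"
proof -
  interpret S: additive_subgroup "F i" A by (rule step_subgroup)
  interpret P: additive_subgroup "pred_step A F i" A by (rule pred_step_subgroup)
  interpret G: abelian_group "A\<lparr>carrier := F i\<rparr>" by (rule step_group)
  have "subgroup (pred_step A F i) (add_monoid A\<lparr>carrier := F i\<rparr>)"
    using add.subgroup_incl[OF P.a_subgroup S.a_subgroup pred_step_subset] by simp
  then show ?thesis
    by (intro abelian_subgroupI3 additive_subgroup.intro step_group) simp
qed

lemma piece_comm_group: "comm_group (gr_piece A F i)"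
  unfolding gr_piece_def by (rule abelian_subgroup.a_factorgroup_is_comm_group[OF pred_abelian_subgroup])

lemma coset_restrict [simp]: "P +>\<^bsub>A\<lparr>carrier := S\<rparr>\<^esub> x = P +> x"
  by (simp add: a_r_coset_def r_coset_def)

lemma piece_carrier: "carrier (gr_piece A F i) = (\<lambda>x. pred_step A F i +> x) ` F i"
  by (auto simp: gr_piece_def A_FactGroup_def' A_RCOSETS_def' )

lemma piece_one [simp]: "\<one>\<^bsub>gr_piece A F i\<^esub> = pred_step A F i"
  by (simp add: gr_piece_def A_FactGroup_def')

lemma piece_mult: assumes "x \<in> F i" "y \<in> F i"
  shows "(pred_step A F i +> x) \<otimes>\<^bsub>gr_piece A F i\<^esub> (pred_step A F i +> y) = pred_step A F i +> (x \<oplus> y)"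
  using abelian_subgroup.a_rcos_sum[OF pred_abelian_subgroup[of i], of x y] assms
  by (simp add: gr_piece_def)

lemma coset_eq: assumes "x \<in> carrier A" "y \<in> carrier A"
  shows "pred_step A F i +> x = pred_step A F i +> y \<longleftrightarrow> x \<ominus> y \<in> pred_step A F i"
proof -
  interpret P: abelian_subgroup "pred_step A F i" A
    by (rule abelian_subgroupI3[OF pred_step_subgroup abelian_group_axioms])
  show ?thesis
    using P.a_rcos_module[of y x] P.a_rcos_self[of x] assms
      a_repr_independence[OF _ assms(2) P.a_subgroup, of x]
    by (auto simp: minus_eq)
qed

lemma coset_self: "x \<in> carrier A \<Longrightarrow> x \<in> pred_step A F i +> x"
  using abelian_subgroup.a_rcos_self[OF abelian_subgroupI3[OF pred_step_subgroup abelian_group_axioms]] by blast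

lemma coset_pred: "pred_step A F i +> x = pred_step A F i \<longleftrightarrow> x \<in> pred_step A F i" if "x \<in> carrier A"
  using coset_eq[of x \<zero> i] that additive_subgroup.a_subset[OF pred_step_subgroup[of i]]
  by (simp add: minus_eq a_inv_def)

text \<open>\<open>rep a\<close> says that \<open>a\<close> is a sequence of representatives of the components of an element
  of the associated graded group, and \<open>cls a\<close> is that element.\<close>

definition rep :: "(nat \<Rightarrow> 'a) \<Rightarrow> bool"
  where "rep a \<longleftrightarrow> (\<forall>i. a i \<in> F i) \<and> finite {i. a i \<notin> pred_step A F i}"

definition cls :: "(nat \<Rightarrow> 'a) \<Rightarrow> nat \<Rightarrow> 'a set"
  where "cls a = (\<lambda>i. pred_step A F i +> a i)"

lemma gr_carrier: "carrier (gr_group A F) = cls ` {a. rep a}"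
proof -
  have 1: "carrier (gr_group A F) =
    {f. (\<forall>i. f i \<in> carrier (gr_piece A F i)) \<and> finite {i. f i \<noteq> pred_step A F i}}"
    unfolding gr_group_def
    by (subst carrier_sum_group) (auto simp: comm_group.axioms(2)[OF piece_comm_group])
  show ?thesis
  proof safe
    fix f assume f: "f \<in> carrier (gr_group A F)"
    then have "\<forall>i. \<exists>x. x \<in> F i \<and> f i = pred_step A F i +> x"
      unfolding 1 piece_carrier by blast
    then obtain a where a: "\<And>i. a i \<in> F i" "\<And>i. f i = pred_step A F i +> a i" by metis
    have "f = cls a" using a by (auto simp: cls_def)
    moreover have "pred_step A F i +> a i = pred_step A F i \<longleftrightarrow> a i \<in> pred_step A F i" for i
      using a(1) step_carrier coset_pred by blast
    then have "rep a" using f a unfolding 1 rep_def by auto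
    ultimately show "f \<in> cls ` {a. rep a}" by blast
  next
    fix a assume a: "rep a"
    have "pred_step A F i +> a i = pred_step A F i \<longleftrightarrow> a i \<in> pred_step A F i" for i
      using a step_carrier coset_pred unfolding rep_def by blast
    then show "cls a \<in> carrier (gr_group A F)"
      using a unfolding 1 rep_def cls_def piece_carrier by auto
  qed
qed

lemma gr_add: "rep a \<Longrightarrow> rep b \<Longrightarrow> cls a \<otimes>\<^bsub>gr_group A F\<^esub> cls b = cls (\<lambda>i. a i \<oplus> b i)"
  by (auto simp: gr_group_def cls_def rep_def piece_mult)

lemma gr_zero: "\<one>\<^bsub>gr_group A F\<^esub> = cls (\<lambda>i. \<zero>)"
  using coset_pred additive_subgroup.zero_closed[OF pred_step_subgroup]
  by (auto simp: gr_group_def cls_def fun_eq_iff)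

lemma gr_comm_group: "comm_group (gr_group A F)"
proof -
  have g: "group (gr_group A F)"
    unfolding gr_group_def by (intro sum_group comm_group.axioms(2) piece_comm_group)
  have comm: "cls (\<lambda>i. a i \<oplus> b i) = cls (\<lambda>i. b i \<oplus> a i)" if "rep a" "rep b" for a b
  proof -
    have "a i \<in> carrier A" "b i \<in> carrier A" for i
      using that step_carrier by (auto simp: rep_def)
    then show ?thesis by (simp add: a_comm)
  qed
  show ?thesis
    by (rule group.group_comm_groupI[OF g])
      (use comm in \<open>auto simp: gr_carrier gr_add\<close>)
qed

lemma piece_finprod:
  assumes "finite S" "\<And>i. i \<in> S \<Longrightarrow> h i \<in> F k"
  shows "finprod (gr_piece A F k) (\<lambda>i. pred_step A F k +> h i) S = pred_step A F k +> finsum A h S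
    \<and> finsum A h S \<in> F k"
proof -
  interpret P: comm_group "gr_piece A F k" by (rule piece_comm_group)
  interpret S: additive_subgroup "F k" A by (rule step_subgroup)
  show ?thesis using assms
  proof (induction S rule: finite_induct)
    case empty then show ?case using coset_pred[of \<zero> k] additive_subgroup.zero_closed[OF pred_step_subgroup[of k]] S.zero_closed by simp
  next
    case (insert x S)
    have c: "(\<lambda>i. pred_step A F k +> h i) \<in> S \<rightarrow> carrier (gr_piece A F k)"
      using insert by (auto simp: piece_carrier)
    have d: "h \<in> S \<rightarrow> carrier A" using insert step_carrier by auto
    have hx: "h x \<in> F k" using insert by auto
    have "finprod (gr_piece A F k) (\<lambda>i. pred_step A F k +> h i) (insert x S)
      = (pred_step A F k +> h x) \<otimes>\<^bsub>gr_piece A F k\<^esub> finprod (gr_piece A F k) (\<lambda>i. pred_step A F k +> h i) S"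
      by (rule P.finprod_insert) (use insert c hx in \<open>auto simp: piece_carrier\<close>)
    also have "\<dots> = pred_step A F k +> (h x \<oplus> finsum A h S)"
      using insert hx by (simp add: piece_mult)
    also have "h x \<oplus> finsum A h S = finsum A h (insert x S)"
      using insert d hx step_carrier by (simp add: finsum_insert)
    finally show ?case
      using insert hx S.a_closed[of "h x" "finsum A h S"] d step_carrier by (simp add: finsum_insert)
  qed
qed

lemma step_mono': "i \<le> j \<Longrightarrow> F i \<subseteq> F j"
  by (rule lift_Suc_mono_le[of F]) (rule step_mono)

lemma finsum_pred: assumes "finite S" "\<And>i. i \<in> S \<Longrightarrow> h i \<in> pred_step A F k"
  shows "finsum A h S \<in> pred_step A F k"
proof -
  interpret P: additive_subgroup "pred_step A F k" A by (rule pred_step_subgroup)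
  show ?thesis using assms
  proof (induction S rule: finite_induct)
    case (insert x S)
    then have "h \<in> S \<rightarrow> carrier A" "h x \<in> carrier A" using P.a_Hcarr by auto
    then show ?case using insert by (simp add: finsum_insert P.a_closed)
  qed (simp add: P.zero_closed)
qed

lemma rep_carrier: "rep a \<Longrightarrow> a i \<in> carrier A"
  using step_carrier by (auto simp: rep_def)

lemma rep_bound: "rep a \<Longrightarrow> \<exists>n. \<forall>i\<ge>n. a i \<in> pred_step A F i"
  unfolding rep_def finite_nat_set_iff_bounded
  by (metis (mono_tags, lifting) linorder_not_less mem_Collect_eq)

lemma rep_boundI: "(\<And>i. a i \<in> F i) \<Longrightarrow> (\<And>i. i \<ge> n \<Longrightarrow> a i \<in> pred_step A F i) \<Longrightarrow> rep a"
  unfolding rep_def finite_nat_set_iff_bounded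
  by (metis (mono_tags, lifting) linorder_not_less mem_Collect_eq)

lemma rep_zero: "rep (\<lambda>i. \<zero>)"
  by (rule rep_boundI) (auto intro: additive_subgroup.zero_closed step_subgroup pred_step_subgroup)

lemma rep_add: "rep a \<Longrightarrow> rep b \<Longrightarrow> rep (\<lambda>i. a i \<oplus> b i)"
proof -
  assume r: "rep a" "rep b"
  obtain n m where "\<forall>i\<ge>n. a i \<in> pred_step A F i" "\<forall>i\<ge>m. b i \<in> pred_step A F i"
    using r rep_bound by metis
  then show ?thesis using r
    by (intro rep_boundI[of _ "max n m"])
      (auto simp: rep_def intro: additive_subgroup.a_closed step_subgroup pred_step_subgroup)
qed

lemma coset_elem: "x \<in> F i \<Longrightarrow> y \<in> pred_step A F i +> x \<Longrightarrow>
    y \<in> F i \<and> y \<ominus> x \<in> pred_step A F i"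
proof -
  assume x: "x \<in> F i" and y: "y \<in> pred_step A F i +> x"
  interpret P: abelian_subgroup "pred_step A F i" A
    by (rule abelian_subgroupI3[OF pred_step_subgroup abelian_group_axioms])
  obtain h where h: "h \<in> pred_step A F i" "y = h \<oplus> x" using y by (auto simp: a_r_coset_def')
  then have "y \<in> F i" using x pred_step_subset additive_subgroup.a_closed[OF step_subgroup] by blast
  then show ?thesis using P.a_rcos_module[of x y] x y step_carrier by (auto simp: minus_eq)
qed

end

context left_module begin

lemma l_null: "x \<in> carrier M \<Longrightarrow> \<zero> \<odot>\<^bsub>M\<^esub> x = \<zero>\<^bsub>M\<^esub>"
  using smult_l_distr[of \<zero> \<zero> x] by (metis M.add.r_cancel_one' R.l_zero R.zero_closed smult_closed)

lemma r_null: "a \<in> carrier R \<Longrightarrow> a \<odot>\<^bsub>M\<^esub> \<zero>\<^bsub>M\<^esub> = \<zero>\<^bsub>M\<^esub>"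
  using smult_r_distr[of a "\<zero>\<^bsub>M\<^esub>" "\<zero>\<^bsub>M\<^esub>"] by (metis M.add.r_cancel_one' M.l_zero M.zero_closed smult_closed)

lemma l_minus: "a \<in> carrier R \<Longrightarrow> x \<in> carrier M \<Longrightarrow> (\<ominus> a) \<odot>\<^bsub>M\<^esub> x = \<ominus>\<^bsub>M\<^esub> (a \<odot>\<^bsub>M\<^esub> x)"
  using smult_l_distr[of "\<ominus> a" a x] by (simp add: R.l_neg l_null M.minus_equality)

lemma r_minus: "a \<in> carrier R \<Longrightarrow> x \<in> carrier M \<Longrightarrow> a \<odot>\<^bsub>M\<^esub> (\<ominus>\<^bsub>M\<^esub> x) = \<ominus>\<^bsub>M\<^esub> (a \<odot>\<^bsub>M\<^esub> x)"
  using smult_r_distr[of a "\<ominus>\<^bsub>M\<^esub> x" x] by (simp add: M.l_neg r_null M.minus_equality)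

lemma smult_finsum_r: assumes "finite S" "a \<in> carrier R" "h \<in> S \<rightarrow> carrier M"
  shows "a \<odot>\<^bsub>M\<^esub> finsum M h S = finsum M (\<lambda>i. a \<odot>\<^bsub>M\<^esub> h i) S"
  using assms by (induction S rule: finite_induct) (auto simp: r_null smult_r_distr Pi_def)

lemma conv_assoc:
  assumes "a \<in> UNIV \<rightarrow> carrier R" "b \<in> UNIV \<rightarrow> carrier R" "c \<in> UNIV \<rightarrow> carrier M"
  shows "k \<le> (n::nat) \<Longrightarrow>
    (\<Oplus>\<^bsub>M\<^esub>j \<in> {..k}. (\<Oplus>i \<in> {..j}. a i \<otimes> b (j-i)) \<odot>\<^bsub>M\<^esub> c (n-j)) =
    (\<Oplus>\<^bsub>M\<^esub>j \<in> {..k}. a j \<odot>\<^bsub>M\<^esub> (\<Oplus>\<^bsub>M\<^esub>i \<in> {..k-j}. b i \<odot>\<^bsub>M\<^esub> c (n-j-i)))"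
  (is "_ \<Longrightarrow> ?eq k")
proof (induct k)
  case 0 then show ?case using assms by (simp add: Pi_def smult_assoc1)
next
  case (Suc k)
  have fs: "(\<Oplus>i \<in> {..j}. a i \<otimes> b (j-i)) \<in> carrier R" for j
    using assms by (auto simp: Pi_def)
  have e: "(\<Oplus>i \<in> {..j}. a i \<otimes> b (j-i)) \<odot>\<^bsub>M\<^esub> y = (\<Oplus>\<^bsub>M\<^esub>i \<in> {..j}. (a i \<otimes> b (j-i)) \<odot>\<^bsub>M\<^esub> y)"
    "(\<Oplus>i \<in> {..j}. a i \<otimes> b (Suc j-i)) \<odot>\<^bsub>M\<^esub> y = (\<Oplus>\<^bsub>M\<^esub>i \<in> {..j}. (a i \<otimes> b (Suc j-i)) \<odot>\<^bsub>M\<^esub> y)"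
    if "y \<in> carrier M" for j y
  proof -
    have "finsum R f S \<odot>\<^bsub>M\<^esub> y = finsum M (\<lambda>i. f i \<odot>\<^bsub>M\<^esub> y) S"
      if "finite S" "f \<in> S \<rightarrow> carrier R" for f S
      using that \<open>y \<in> carrier M\<close>
      by (induction S rule: finite_induct) (auto simp: l_null smult_l_distr Pi_def)
    from this[of "{..j}" "\<lambda>i. a i \<otimes> b (j-i)"] this[of "{..j}" "\<lambda>i. a i \<otimes> b (Suc j-i)"]
    show "(\<Oplus>i \<in> {..j}. a i \<otimes> b (j-i)) \<odot>\<^bsub>M\<^esub> y = (\<Oplus>\<^bsub>M\<^esub>i \<in> {..j}. (a i \<otimes> b (j-i)) \<odot>\<^bsub>M\<^esub> y)"
      "(\<Oplus>i \<in> {..j}. a i \<otimes> b (Suc j-i)) \<odot>\<^bsub>M\<^esub> y = (\<Oplus>\<^bsub>M\<^esub>i \<in> {..j}. (a i \<otimes> b (Suc j-i)) \<odot>\<^bsub>M\<^esub> y)"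
      using assms by (auto simp: Pi_def)
  qed
  have "?eq k" using Suc by auto
  then show ?case using assms Suc.prems
    by (simp cong: M.finsum_cong add: Suc_diff_le Pi_def smult_r_distr smult_l_distr smult_assoc1 fs)
       (simp cong: M.finsum_cong add: Pi_def M.a_ac e smult_assoc1 Suc_diff_le)
qed

end

context filtered_module begin

lemma pred_smult:
  assumes "a \<in> FB i" "x \<in> FM j" "a \<in> pred_step B FB i \<or> x \<in> pred_step M FM j"
  shows "a \<odot>\<^bsub>M\<^esub> x \<in> pred_step M FM (i + j)"
proof -
  have z: "\<zero>\<^bsub>M\<^esub> \<in> pred_step M FM k" for k
    by (rule additive_subgroup.zero_closed[OF FM.pred_step_subgroup])
  note c = FB.step_carrier[OF assms(1)] FM.step_carrier[OF assms(2)]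
  from assms(3) show ?thesis
  proof
    assume "a \<in> pred_step B FB i"
    then show ?thesis using z[of j] c assms(2) smult_step[of a "i - 1" x j]
      by (cases i) (auto simp: pred_step_def l_null)
  next
    assume "x \<in> pred_step M FM j"
    then show ?thesis using z[of i] c assms(1) smult_step[of a i x "j - 1"]
      by (cases j) (auto simp: pred_step_def r_null)
  qed
qed

lemma coset_smult:
  assumes a: "a \<in> FB i" and x: "x \<in> FM j"
  shows "(\<Union>a' \<in> pred_step B FB i +>\<^bsub>B\<^esub> a. \<Union>x' \<in> pred_step M FM j +>\<^bsub>M\<^esub> x.
      pred_step M FM (i+j) +>\<^bsub>M\<^esub> a' \<odot>\<^bsub>M\<^esub> x') = pred_step M FM (i+j) +>\<^bsub>M\<^esub> a \<odot>\<^bsub>M\<^esub> x"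
proof -
  have *: "pred_step M FM (i+j) +>\<^bsub>M\<^esub> a' \<odot>\<^bsub>M\<^esub> x' = pred_step M FM (i+j) +>\<^bsub>M\<^esub> a \<odot>\<^bsub>M\<^esub> x"
    if "a' \<in> pred_step B FB i +>\<^bsub>B\<^esub> a" "x' \<in> pred_step M FM j +>\<^bsub>M\<^esub> x" for a' x'
  proof -
    have A: "a' \<in> FB i" "a' \<ominus>\<^bsub>B\<^esub> a \<in> pred_step B FB i"
      and X: "x' \<in> FM j" "x' \<ominus>\<^bsub>M\<^esub> x \<in> pred_step M FM j"
      using FB.coset_elem[OF a that(1)] FM.coset_elem[OF x that(2)] by auto
    have c: "a \<in> carrier B" "a' \<in> carrier B" "x \<in> carrier M" "x' \<in> carrier M"
      using a x A(1) X(1) FB.step_carrier FM.step_carrier by auto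
    have "a' \<odot>\<^bsub>M\<^esub> x' \<ominus>\<^bsub>M\<^esub> a \<odot>\<^bsub>M\<^esub> x
        = (a' \<ominus>\<^bsub>B\<^esub> a) \<odot>\<^bsub>M\<^esub> x' \<oplus>\<^bsub>M\<^esub> a \<odot>\<^bsub>M\<^esub> (x' \<ominus>\<^bsub>M\<^esub> x)"
      using c by (simp add: R.minus_eq M.minus_eq smult_l_distr smult_r_distr l_minus r_minus
        M.a_assoc M.r_neg1)
    moreover have "(a' \<ominus>\<^bsub>B\<^esub> a) \<odot>\<^bsub>M\<^esub> x' \<in> pred_step M FM (i+j)"
      using A X FB.pred_step_subset by (intro pred_smult) auto
    moreover have "a \<odot>\<^bsub>M\<^esub> (x' \<ominus>\<^bsub>M\<^esub> x) \<in> pred_step M FM (i+j)"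
      using a X FM.pred_step_subset by (intro pred_smult) auto
    ultimately have "a' \<odot>\<^bsub>M\<^esub> x' \<ominus>\<^bsub>M\<^esub> a \<odot>\<^bsub>M\<^esub> x \<in> pred_step M FM (i+j)"
      using additive_subgroup.a_closed[OF FM.pred_step_subgroup] by metis
    then show ?thesis using FM.coset_eq c by auto
  qed
  have "a \<in> pred_step B FB i +>\<^bsub>B\<^esub> a" "x \<in> pred_step M FM j +>\<^bsub>M\<^esub> x"
    using a x FB.step_carrier FM.step_carrier FB.coset_self FM.coset_self by auto
  then show ?thesis using * by blast
qed

definition conv :: "(nat \<Rightarrow> 'a) \<Rightarrow> (nat \<Rightarrow> 'b) \<Rightarrow> nat \<Rightarrow> 'b" where
  "conv a m = (\<lambda>k. \<Oplus>\<^bsub>M\<^esub>i \<in> {..k}. a i \<odot>\<^bsub>M\<^esub> m (k - i))"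

lemma gr_mult_cls:
  assumes a: "FB.rep a" and m: "FM.rep m"
  shows "gr_mult M FM (\<lambda>a x. a \<odot>\<^bsub>M\<^esub> x) (FB.cls a) (FM.cls m) = FM.cls (conv a m)"
    and rep_conv: "FM.rep (conv a m)"
proof -
  have t: "a i \<odot>\<^bsub>M\<^esub> m (k - i) \<in> FM k" if "i \<le> k" for i k
    using smult_step[of "a i" i "m (k-i)" "k-i"] a m that by (simp add: FB.rep_def FM.rep_def)
  have u: "(\<Union>x \<in> FB.cls a i. \<Union>y \<in> FM.cls m (k - i). pred_step M FM k +>\<^bsub>M\<^esub> x \<odot>\<^bsub>M\<^esub> y) =
     pred_step M FM k +>\<^bsub>M\<^esub> a i \<odot>\<^bsub>M\<^esub> m (k - i)" if "i \<le> k" for i k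
    using coset_smult[of "a i" i "m (k-i)" "k-i"] a m that
    by (simp add: FB.rep_def FM.rep_def FB.cls_def FM.cls_def)
  have v: "finprod (gr_piece M FM k) (\<lambda>i. \<Union>x \<in> FB.cls a i. \<Union>y \<in> FM.cls m (k - i).
      pred_step M FM k +>\<^bsub>M\<^esub> x \<odot>\<^bsub>M\<^esub> y) {..k} = pred_step M FM k +>\<^bsub>M\<^esub> conv a m k"
     and w: "conv a m k \<in> FM k" for k
  proof -
    interpret P: comm_group "gr_piece M FM k" by (rule FM.piece_comm_group)
    have "finprod (gr_piece M FM k) (\<lambda>i. \<Union>x \<in> FB.cls a i. \<Union>y \<in> FM.cls m (k - i).
      pred_step M FM k +>\<^bsub>M\<^esub> x \<odot>\<^bsub>M\<^esub> y) {..k} =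
      finprod (gr_piece M FM k) (\<lambda>i. pred_step M FM k +>\<^bsub>M\<^esub> a i \<odot>\<^bsub>M\<^esub> m (k - i)) {..k}"
      by (rule P.finprod_cong') (auto simp: u t FM.piece_carrier)
    then show "finprod (gr_piece M FM k) (\<lambda>i. \<Union>x \<in> FB.cls a i. \<Union>y \<in> FM.cls m (k - i).
      pred_step M FM k +>\<^bsub>M\<^esub> x \<odot>\<^bsub>M\<^esub> y) {..k} = pred_step M FM k +>\<^bsub>M\<^esub> conv a m k"
      "conv a m k \<in> FM k"
      using FM.piece_finprod[of "{..k}" "\<lambda>i. a i \<odot>\<^bsub>M\<^esub> m (k - i)" k] t by (auto simp: conv_def)
  qed
  show "gr_mult M FM (\<lambda>a x. a \<odot>\<^bsub>M\<^esub> x) (FB.cls a) (FM.cls m) = FM.cls (conv a m)"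
    unfolding gr_mult_def v by (simp add: FM.cls_def)
  obtain p q where p: "\<And>i. i \<ge> p \<Longrightarrow> a i \<in> pred_step B FB i"
    and q: "\<And>i. i \<ge> q \<Longrightarrow> m i \<in> pred_step M FM i"
    using FB.rep_bound[OF a] FM.rep_bound[OF m] by metis
  show "FM.rep (conv a m)"
  proof (rule FM.rep_boundI[of _ "p + q"])
    fix k assume k: "k \<ge> p + q"
    have "a i \<odot>\<^bsub>M\<^esub> m (k - i) \<in> pred_step M FM k" if "i \<le> k" for i
    proof -
      have "i \<ge> p \<or> k - i \<ge> q" using k by linarith
      then show ?thesis using p q pred_smult[of "a i" i "m (k-i)" "k-i"] a m that
        by (auto simp: FB.rep_def FM.rep_def)
    qed
    then show "conv a m k \<in> pred_step M FM k"
      unfolding conv_def by (intro FM.finsum_pred) auto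
  qed (rule w)
qed

lemma conv_add_l: "FB.rep a \<Longrightarrow> FB.rep b \<Longrightarrow> FM.rep m \<Longrightarrow>
    conv (\<lambda>i. a i \<oplus>\<^bsub>B\<^esub> b i) m = (\<lambda>k. conv a m k \<oplus>\<^bsub>M\<^esub> conv b m k)"
proof -
  assume "FB.rep a" "FB.rep b" "FM.rep m"
  then have c: "\<And>i. a i \<in> carrier B" "\<And>i. b i \<in> carrier B" "\<And>i. m i \<in> carrier M"
    using FB.rep_carrier FM.rep_carrier by blast+
  then show ?thesis unfolding conv_def
    by (subst M.finsum_addf[symmetric]) (auto simp: smult_l_distr)
qed

lemma conv_add_r: "FB.rep a \<Longrightarrow> FM.rep n \<Longrightarrow> FM.rep m \<Longrightarrow>
    conv a (\<lambda>i. n i \<oplus>\<^bsub>M\<^esub> m i) = (\<lambda>k. conv a n k \<oplus>\<^bsub>M\<^esub> conv a m k)"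
proof -
  assume "FB.rep a" "FM.rep n" "FM.rep m"
  then have c: "\<And>i. a i \<in> carrier B" "\<And>i. n i \<in> carrier M" "\<And>i. m i \<in> carrier M"
    using FB.rep_carrier FM.rep_carrier by blast+
  then show ?thesis unfolding conv_def
    by (subst M.finsum_addf[symmetric]) (auto simp: smult_r_distr)
qed

lemma conv_one: "FM.rep m \<Longrightarrow>
    conv (\<lambda>i. if i = 0 then \<one>\<^bsub>B\<^esub> else \<zero>\<^bsub>B\<^esub>) m = m"
proof
  fix k assume "FM.rep m"
  then have c: "\<And>i. m i \<in> carrier M" using FM.rep_carrier by blast+
  have "conv (\<lambda>i. if i = 0 then \<one>\<^bsub>B\<^esub> else \<zero>\<^bsub>B\<^esub>) m k = (\<Oplus>\<^bsub>M\<^esub>i \<in> {..k}. if 0 = i then m (k - i) else \<zero>\<^bsub>M\<^esub>)"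
    unfolding conv_def by (rule M.finsum_cong') (auto simp: c l_null)
  also have "\<dots> = m (k - 0)"
    by (rule M.finsum_singleton) (auto simp: c)
  finally show "conv (\<lambda>i. if i = 0 then \<one>\<^bsub>B\<^esub> else \<zero>\<^bsub>B\<^esub>) m k = m k" by simp
qed

lemma conv_conv: "FB.rep a \<Longrightarrow> FB.rep b \<Longrightarrow> FM.rep m \<Longrightarrow>
    conv (\<lambda>k. \<Oplus>\<^bsub>B\<^esub>i \<in> {..k}. a i \<otimes>\<^bsub>B\<^esub> b (k - i)) m = conv a (conv b m)"
proof
  fix k assume "FB.rep a" "FB.rep b" "FM.rep m"
  then have c: "\<And>i. a i \<in> carrier B" "\<And>i. b i \<in> carrier B" "\<And>i. m i \<in> carrier M"
    using FB.rep_carrier FM.rep_carrier by blast+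
  then show "conv (\<lambda>k. \<Oplus>\<^bsub>B\<^esub>i \<in> {..k}. a i \<otimes>\<^bsub>B\<^esub> b (k - i)) m k = conv a (conv b m) k"
    unfolding conv_def using conv_assoc[of a b m k k] by (auto simp: Pi_def)
qed

end

text \<open>The ring as a left module over itself; the ring axioms of the associated graded ring are
  obtained from the module case.\<close>

definition regular_module :: "('a, 'r) ring_scheme \<Rightarrow> ('a, 'a) module"
  where "regular_module B = \<lparr>carrier = carrier B, monoid.mult = (\<lambda>x y. x \<otimes>\<^bsub>B\<^esub> y), one = \<one>\<^bsub>B\<^esub>,
    zero = \<zero>\<^bsub>B\<^esub>, add = (\<lambda>x y. x \<oplus>\<^bsub>B\<^esub> y), smult = (\<lambda>x y. x \<otimes>\<^bsub>B\<^esub> y)\<rparr>"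

lemma regular_simps [simp]:
  "carrier (regular_module B) = carrier B" "\<zero>\<^bsub>regular_module B\<^esub> = \<zero>\<^bsub>B\<^esub>"
  "x \<oplus>\<^bsub>regular_module B\<^esub> y = x \<oplus>\<^bsub>B\<^esub> y" "x \<odot>\<^bsub>regular_module B\<^esub> y = x \<otimes>\<^bsub>B\<^esub> y"
  by (simp_all add: regular_module_def)

lemma regular_pred [simp]: "pred_step (regular_module B) F = pred_step B F"
  by (rule ext) (simp add: pred_step_def split: nat.split)

lemma regular_coset [simp]: "P +>\<^bsub>regular_module B\<^esub> x = P +>\<^bsub>B\<^esub> x"
  by (simp add: a_r_coset_def r_coset_def)

lemma regular_piece [simp]: "gr_piece (regular_module B) F = gr_piece B F"
  by (simp add: gr_piece_def fun_eq_iff A_FactGroup_def FactGroup_def RCOSETS_def r_coset_def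
    set_mult_def)

lemma regular_mult [simp]: "gr_mult (regular_module B) F = gr_mult B F"
  by (simp add: gr_mult_def fun_eq_iff)

lemma (in filtered_ring) regular: "filtered_module B FB (regular_module B) FB"
proof -
  have g: "abelian_group (regular_module B)"
    by (intro abelian_groupI) (auto simp: a_ac intro!: bexI[of _ "\<ominus> _"] l_neg)
  interpret M: left_module B "regular_module B"
    by (intro left_module.intro left_module_axioms.intro ring_axioms g)
       (auto simp: l_distr r_distr m_assoc)
  interpret F: filtration "regular_module B" FB
    by (intro filtration.intro filtration_axioms.intro g step_mono)
      (use step_subgroup in \<open>auto simp: exhaustive additive_subgroup_def subgroup_def regular_module_def a_inv_def m_inv_def\<close>)
  show ?thesis
    by (intro filtered_module.intro filtered_module_axioms.intro M.left_module_axioms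
      F.filtration_axioms filtered_ring_axioms) (simp add: mult_step)
qed

context filtered_ring begin

interpretation Reg: filtered_module B FB "regular_module B" FB by (rule regular)

lemma reg_rep: "Reg.FM.rep = rep"
  by (simp add: fun_eq_iff Reg.FM.rep_def rep_def)
lemma reg_cls: "Reg.FM.cls = cls"
  by (simp add: fun_eq_iff Reg.FM.cls_def cls_def)

lemma gr_ring_mult: "rep a \<Longrightarrow> rep b \<Longrightarrow>
    cls a \<otimes>\<^bsub>gr_ring B FB\<^esub> cls b = cls (Reg.conv a b)"
  using Reg.gr_mult_cls(1)[of a b] by (simp add: gr_ring_def reg_rep reg_cls)

lemma rep_conv': "rep a \<Longrightarrow> rep b \<Longrightarrow> rep (Reg.conv a b)"
  using Reg.rep_conv[of a b] by (simp add: reg_rep)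

lemma finsum_reg: "finsum (regular_module B) = finsum B"
  by (simp add: fun_eq_iff finsum_def finprod_def regular_module_def)

lemma conv_reg: "Reg.conv a b = (\<lambda>k. \<Oplus>i \<in> {..k}. a i \<otimes> b (k - i))"
  by (simp add: Reg.conv_def finsum_reg)

lemma gr_ring_one: "\<one>\<^bsub>gr_ring B FB\<^esub> = cls (\<lambda>i. if i = 0 then \<one> else \<zero>)"
proof -
  have "\<zero> \<in> pred_step B FB i" for i by (rule additive_subgroup.zero_closed[OF pred_step_subgroup])
  then have "pred_step B FB i = pred_step B FB i +> \<zero>" for i using coset_pred[of \<zero> i] by simp
  then show ?thesis by (simp add: gr_ring_def gr_homog_def cls_def fun_eq_iff)
qed

lemma rep_one: "rep (\<lambda>i. if i = 0 then \<one> else \<zero>)"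
  by (rule rep_boundI[of _ 1]) (auto simp: one_step intro: additive_subgroup.zero_closed pred_step_subgroup step_subgroup)

lemma gr_ring_carrier: "carrier (gr_ring B FB) = cls ` {a. rep a}"
  by (simp add: gr_ring_def gr_carrier)

lemma gr_ring_add: "rep a \<Longrightarrow> rep b \<Longrightarrow> cls a \<oplus>\<^bsub>gr_ring B FB\<^esub> cls b = cls (\<lambda>i. a i \<oplus> b i)"
  by (simp add: gr_ring_def gr_add)

lemma conv_one_r: "rep a \<Longrightarrow> Reg.conv a (\<lambda>i. if i = 0 then \<one> else \<zero>) = a"
proof
  fix k assume "rep a"
  then have c: "\<And>i. a i \<in> carrier B" using rep_carrier by blast+
  have "Reg.conv a (\<lambda>i. if i = 0 then \<one> else \<zero>) k = (\<Oplus>i \<in> {..k}. if k = i then a i else \<zero>)"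
    unfolding conv_reg by (rule finsum_cong') (auto simp: c)
  also have "\<dots> = a k"
    by (rule finsum_singleton) (auto simp: c)
  finally show "Reg.conv a (\<lambda>i. if i = 0 then \<one> else \<zero>) k = a k" .
qed

theorem gr_ring_is_ring: "ring (gr_ring B FB)"
proof (rule ringI)
  interpret G: comm_group "gr_group B FB" by (rule gr_comm_group)
  show "abelian_group (gr_ring B FB)"
    by (rule abelian_groupI)
      (auto simp: gr_ring_def G.m_ac intro!: bexI[of _ "inv\<^bsub>gr_group B FB\<^esub> _"])
  show "monoid (gr_ring B FB)"
    by (rule monoidI)
      (auto simp: gr_ring_carrier gr_ring_mult gr_ring_one rep_one rep_conv' conv_one_r Reg.conv_one reg_rep
        Reg.conv_conv[unfolded reg_rep, folded conv_reg])
qed (auto simp: gr_ring_carrier gr_ring_mult gr_ring_add rep_add rep_conv'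
       Reg.conv_add_l[unfolded reg_rep, simplified] Reg.conv_add_r[unfolded reg_rep, simplified])

end

context filtered_module begin

lemma gr_module_carrier: "carrier (gr_module M FM) = FM.cls ` {a. FM.rep a}"
  by (simp add: gr_module_def FM.gr_carrier)

lemma gr_module_add: "FM.rep a \<Longrightarrow> FM.rep b \<Longrightarrow> FM.cls a \<oplus>\<^bsub>gr_module M FM\<^esub> FM.cls b = FM.cls (\<lambda>i. a i \<oplus>\<^bsub>M\<^esub> b i)"
  by (simp add: gr_module_def FM.gr_add)

lemma gr_module_smult: "FB.rep a \<Longrightarrow> FM.rep b \<Longrightarrow> FB.cls a \<odot>\<^bsub>gr_module M FM\<^esub> FM.cls b = FM.cls (conv a b)"
  by (simp add: gr_module_def gr_mult_cls)

theorem gr_module_is_module: "left_module (gr_ring B FB) (gr_module M FM)"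
proof (intro left_module.intro left_module_axioms.intro FB.gr_ring_is_ring)
  interpret G: comm_group "gr_group M FM" by (rule FM.gr_comm_group)
  show "abelian_group (gr_module M FM)"
    by (rule abelian_groupI)
      (auto simp: gr_module_def G.m_ac intro!: bexI[of _ "inv\<^bsub>gr_group M FM\<^esub> _"])
qed (auto simp: FB.gr_ring_carrier gr_module_carrier gr_module_smult gr_module_add
   FB.gr_ring_mult FB.gr_ring_add FB.rep_add FM.rep_add FB.rep_conv' rep_conv conv_add_l conv_add_r
   FB.conv_reg conv_conv FB.gr_ring_one FB.rep_one conv_one FB.rep_conv'[unfolded FB.conv_reg])

end

end

theory Submission
  imports Defs
begin

text \<open>Division of \<open>gr(u)\<close> by \<open>gr(v)\<close> in the graded module, read off in the degree of \<open>u\<close>, where the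
  remainder contributes nothing, gives a homogeneous \<open>q\<close> such that \<open>u - qv\<close> has smaller degree
  than \<open>u\<close>.  Iterating this is division with remainder in \<open>M\<close>.  In a Euclidean module every nonzero
  element of minimal degree of a submodule generates it, and the elements of minimal degree
  of \<open>gr(N)\<close> are homogeneous, hence leading terms of elements of \<open>N\<close> and trivially
  uni-annihilators.\<close>

section \<open>Submodules of left modules\<close>

lemma (in left_module) cyclic_submodule_subset:
  assumes "submodule N R M" "x \<in> N"
  shows "cyclic_submodule R M x \<subseteq> N"
  using assms submodule.smult_closed by (fastforce simp: cyclic_submodule_def)

text \<open>Closure under negation, which \<open>submodule\<close> demands through its subgroup
  part, comes from multiplication by -1.\<close>

lemma (in left_module) submoduleI:
  assumes sub: "N \<subseteq> carrier M" and zero: "\<zero>\<^bsub>M\<^esub> \<in> N"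
    and add: "\<And>x y. x \<in> N \<Longrightarrow> y \<in> N \<Longrightarrow> x \<oplus>\<^bsub>M\<^esub> y \<in> N"
    and smult: "\<And>a x. a \<in> carrier R \<Longrightarrow> x \<in> N \<Longrightarrow> a \<odot>\<^bsub>M\<^esub> x \<in> N"
  shows "submodule N R M"
proof -
  have "\<ominus>\<^bsub>M\<^esub> x \<in> N" if "x \<in> N" for x
    using smult[of "\<ominus> \<one>" x] l_minus[of \<one> x] that sub by auto
  then show ?thesis
    using assms unfolding submodule_def submodule_axioms_def
    by (auto intro!: subgroup.intro simp: a_inv_def)
qed

text \<open>\<open>submodule\<close> speaks of a subgroup of the additive monoid, so its facts
  arrive in multiplicative notation; here they are put in additive form.\<close>

lemma (in left_module)
  assumes "submodule N R M"
  shows submodule_subset: "N \<subseteq> carrier M"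
    and submodule_zero: "\<zero>\<^bsub>M\<^esub> \<in> N"
    and submodule_add: "\<lbrakk>x \<in> N; y \<in> N\<rbrakk> \<Longrightarrow> x \<oplus>\<^bsub>M\<^esub> y \<in> N"
    and submodule_minus: "\<lbrakk>x \<in> N; y \<in> N\<rbrakk> \<Longrightarrow> x \<ominus>\<^bsub>M\<^esub> y \<in> N"
proof -
  interpret N: submodule N R M by (rule assms)
  show "N \<subseteq> carrier M" using N.subset by simp
  show "\<zero>\<^bsub>M\<^esub> \<in> N" using N.one_closed by simp
  show *: "x \<oplus>\<^bsub>M\<^esub> y \<in> N" if "x \<in> N" "y \<in> N" for x y using N.m_closed that by simp
  show "\<lbrakk>x \<in> N; y \<in> N\<rbrakk> \<Longrightarrow> x \<ominus>\<^bsub>M\<^esub> y \<in> N"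
    using *[of x "\<ominus>\<^bsub>M\<^esub> y"] N.m_inv_closed[of y] by (simp add: M.minus_eq a_inv_def)
qed

lemma (in left_module) submodule_finsum:
  assumes "submodule N R M" "finite S" "\<And>i. i \<in> S \<Longrightarrow> h i \<in> N"
  shows "finsum M h S \<in> N"
  using assms(2,3)
proof (induction S rule: finite_induct)
  case (insert x S)
  then have "h \<in> S \<rightarrow> carrier M" "h x \<in> carrier M"
    using submodule_subset[OF assms(1)] by auto
  then show ?case using insert by (simp add: submodule_add[OF assms(1)])
qed (simp add: submodule_zero[OF assms(1)])

section \<open>Elements of minimal degree as generators\<close>

lemma min_deg_le: "x \<in> N \<Longrightarrow> x \<noteq> \<zero>\<^bsub>E\<^esub> \<Longrightarrow> min_deg E d N \<le> d x"
  unfolding min_deg_def by (rule Least_le) blast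

lemma min_deg_elts_nonempty:
  assumes "\<zero>\<^bsub>E\<^esub> \<in> N" "N \<noteq> {\<zero>\<^bsub>E\<^esub>}"
  shows "min_deg_elts E d N \<noteq> {}"
proof -
  obtain x where "x \<in> N" "x \<noteq> \<zero>\<^bsub>E\<^esub>" using assms by blast
  then have "\<exists>k. \<exists>x \<in> N. x \<noteq> \<zero>\<^bsub>E\<^esub> \<and> k = d x" by blast
  then have "\<exists>x \<in> N. x \<noteq> \<zero>\<^bsub>E\<^esub> \<and> min_deg E d N = d x"
    unfolding min_deg_def by (rule LeastI_ex)
  then show ?thesis by (auto simp: min_deg_elts_def)
qed

text \<open>Dividing \<open>u\<close> in \<open>N\<close> by \<open>v\<close> leaves the remainder
  \<open>u - qv\<close>, again in \<open>N\<close>; a nonzero one would undercut the minimal degree.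
  The result serves both for \<open>N\<close> in \<open>M\<close> and for gr(\<open>N\<close>) in
  gr(\<open>M\<close>).\<close>

lemma euclidean_module_generator:
  assumes E: "euclidean_module C E d" and N: "submodule N C E" and v: "v \<in> min_deg_elts E d N"
  shows "N = cyclic_submodule C E v"
proof
  interpret left_module C E using E by (simp add: euclidean_module_def)
  have vN: "v \<in> N" "v \<noteq> \<zero>\<^bsub>E\<^esub>" "d v = min_deg E d N"
    using v by (auto simp: min_deg_elts_def)
  have vE: "v \<in> carrier E" using vN submodule_subset[OF N] by blast
  show "cyclic_submodule C E v \<subseteq> N" using N vN(1) by (rule cyclic_submodule_subset)
  show "N \<subseteq> cyclic_submodule C E v"
  proof
    fix u assume u: "u \<in> N"
    then have uE: "u \<in> carrier E" using submodule_subset[OF N] by blast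
    show "u \<in> cyclic_submodule C E v"
    proof (cases "u = \<zero>\<^bsub>E\<^esub>")
      case True
      then show ?thesis
        using vE by (auto simp: cyclic_submodule_def l_null intro!: image_eqI[of _ _ "\<zero>\<^bsub>C\<^esub>"])
    next
      case False
      then obtain q r where q: "q \<in> carrier C" and r: "r \<in> carrier E"
        and eq: "u = q \<odot>\<^bsub>E\<^esub> v \<oplus>\<^bsub>E\<^esub> r" and d: "r = \<zero>\<^bsub>E\<^esub> \<or> d r < d v"
        using E uE vE vN(2) unfolding euclidean_module_def by blast
      have "r = u \<ominus>\<^bsub>E\<^esub> q \<odot>\<^bsub>E\<^esub> v"
        using eq q r vE by (simp add: M.minus_eq M.a_ac M.r_neg1 M.r_neg)
      then have "r \<in> N"
        using submodule_minus[OF N u] submodule.smult_closed[OF N q vN(1)] by simp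
      then have "r = \<zero>\<^bsub>E\<^esub>"
        using d min_deg_le[of r N E d] vN(3) by (metis linorder_not_less)
      then show ?thesis using eq q vE by (auto simp: cyclic_submodule_def)
    qed
  qed
qed

section \<open>Degrees and homogeneous representatives in a filtered group\<close>

context filtration begin

lemma step_subset_pred: "i < j \<Longrightarrow> F i \<subseteq> pred_step A F j"
  using step_mono' by (cases j) (auto simp: pred_step_def)

lemma pred_mono: "i \<le> j \<Longrightarrow> pred_step A F i \<subseteq> pred_step A F j"
  using step_subset_pred[of i j] pred_step_subset[of i] by (cases "i = j") auto

lemma zero_pred [simp]: "\<zero> \<in> pred_step A F i"
  by (rule additive_subgroup.zero_closed[OF pred_step_subgroup])

lemma zero_step [simp]: "\<zero> \<in> F i"
  using pred_step_subset zero_pred by blast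

lemma pred_carrier: "x \<in> pred_step A F i \<Longrightarrow> x \<in> carrier A"
  using pred_step_subset step_carrier by blast

lemma pred_add: "x \<in> pred_step A F i \<Longrightarrow> y \<in> pred_step A F i \<Longrightarrow> x \<oplus> y \<in> pred_step A F i"
  by (rule additive_subgroup.a_closed[OF pred_step_subgroup])

lemma filt_deg_eq:
  assumes "x \<in> F i" "x \<notin> pred_step A F i"
  shows "filt_deg A F x = i"
  unfolding filt_deg_def
proof (rule the_equality)
  fix j assume "x \<in> F j - pred_step A F j"
  then show "j = i"
    using assms step_subset_pred by (metis Diff_iff linorder_neqE_nat subsetD)
qed (use assms in simp)

text \<open>The least \<open>i\<close> with \<open>x\<close> in \<open>F i\<close> qualifies: for
  positive \<open>i\<close> by minimality, and for \<open>i = 0\<close> because the preceding step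
  is zero while \<open>x\<close> is not.\<close>

lemma filt_deg_mem:
  assumes "x \<in> carrier A" "x \<noteq> \<zero>"
  shows "x \<in> F (filt_deg A F x)" "x \<notin> pred_step A F (filt_deg A F x)"
proof -
  define i where "i = (LEAST i. x \<in> F i)"
  have "\<exists>i. x \<in> F i" using assms(1) exhaustive by blast
  then have "x \<in> F i" unfolding i_def by (rule LeastI_ex)
  moreover have "x \<notin> pred_step A F i"
    using assms(2) not_less_Least[of "i - 1" "\<lambda>i. x \<in> F i", folded i_def]
    by (cases i) (auto simp: pred_step_def)
  ultimately show "x \<in> F (filt_deg A F x)" "x \<notin> pred_step A F (filt_deg A F x)"
    using filt_deg_eq by auto
qed

text \<open>Membership in \<open>pred_step\<close> absorbs the convention that zero has degree minus
  infinity. Division is therefore carried out with memberships and translated into degrees only at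
  the end.\<close>

lemma pred_iff_filt_deg:
  assumes "x \<in> carrier A"
  shows "x \<in> pred_step A F i \<longleftrightarrow> x = \<zero> \<or> filt_deg A F x < i"
  using filt_deg_mem[OF assms] step_subset_pred pred_mono
  by (metis linorder_not_less subsetD zero_pred)

text \<open>This is the way back from the graded side: a nonzero homogeneous component lifts to a
  filtered element whose degree is its index.\<close>

lemma rep_component_deg:
  assumes "rep a" "a i \<notin> pred_step A F i"
  shows "a i \<noteq> \<zero>" "filt_deg A F (a i) = i"
  using assms filt_deg_eq[of "a i" i] by (auto simp: rep_def)

definition homog_rep :: "nat \<Rightarrow> 'a \<Rightarrow> nat \<Rightarrow> 'a"
  where "homog_rep i x = (\<lambda>j. if j = i then x else \<zero>)"

lemma rep_homog_rep: "x \<in> F i \<Longrightarrow> rep (homog_rep i x)"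
  by (rule rep_boundI[of _ "Suc i"]) (auto simp: homog_rep_def)

lemma gr_homog_eq_cls: "gr_homog A F i x = cls (homog_rep i x)"
  using coset_pred[of \<zero>] by (intro ext) (simp add: gr_homog_def cls_def homog_rep_def)

lemma cls_eq_iff:
  "rep a \<Longrightarrow> rep b \<Longrightarrow> cls a = cls b \<longleftrightarrow> (\<forall>i. a i \<ominus> b i \<in> pred_step A F i)"
  by (simp add: fun_eq_iff cls_def coset_eq rep_carrier)

end

section \<open>Zero and degree in the graded module, read off representatives\<close>

context filtered_module begin

lemma gr_module_zero: "\<zero>\<^bsub>gr_module M FM\<^esub> i = pred_step M FM i"
  by (simp add: gr_module_def FM.gr_zero FM.cls_def FM.coset_pred)

lemma cls_component: "FM.rep a \<Longrightarrow> FM.cls a i = \<zero>\<^bsub>gr_module M FM\<^esub> i \<longleftrightarrow> a i \<in> pred_step M FM i"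
  by (simp add: gr_module_zero FM.cls_def FM.coset_pred FM.rep_carrier)

lemma cls_zero_iff: "FM.rep a \<Longrightarrow> FM.cls a = \<zero>\<^bsub>gr_module M FM\<^esub> \<longleftrightarrow> (\<forall>i. a i \<in> pred_step M FM i)"
  by (simp add: fun_eq_iff[of "FM.cls a"] cls_component)

lemma graded_deg_cls: "FM.rep a \<Longrightarrow> graded_deg (gr_module M FM) (FM.cls a) = Max {i. a i \<notin> pred_step M FM i}"
  by (simp add: graded_deg_def cls_component)

lemma above_graded_deg:
  assumes "FM.rep a" "graded_deg (gr_module M FM) (FM.cls a) < i"
  shows "a i \<in> pred_step M FM i"
  using assms Max_ge[of "{i. a i \<notin> pred_step M FM i}" i]
  by (auto simp: graded_deg_cls FM.rep_def not_le[symmetric])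

lemma graded_deg_attained:
  assumes "FM.rep a" "FM.cls a \<noteq> \<zero>\<^bsub>gr_module M FM\<^esub>"
  shows "a (graded_deg (gr_module M FM) (FM.cls a)) \<notin>
    pred_step M FM (graded_deg (gr_module M FM) (FM.cls a))"
  using assms Max_in[of "{i. a i \<notin> pred_step M FM i}"]
  by (auto simp: graded_deg_cls cls_zero_iff FM.rep_def)

lemma homog_nonzero:
  assumes "x \<in> FM i" "x \<notin> pred_step M FM i"
  shows "FM.cls (FM.homog_rep i x) \<noteq> \<zero>\<^bsub>gr_module M FM\<^esub>"
  using assms cls_zero_iff[OF FM.rep_homog_rep[OF assms(1)]] by (auto simp: FM.homog_rep_def)

lemma graded_deg_homog:
  assumes "x \<in> FM i" "x \<notin> pred_step M FM i"
  shows "graded_deg (gr_module M FM) (FM.cls (FM.homog_rep i x)) = i"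
proof -
  have "{j. FM.homog_rep i x j \<notin> pred_step M FM j} = {i}"
    using assms by (auto simp: FM.homog_rep_def)
  then show ?thesis by (simp add: graded_deg_cls[OF FM.rep_homog_rep[OF assms(1)]])
qed

section \<open>Lifting division from the graded module\<close>

text \<open>Since \<open>homog_rep b v\<close> is concentrated in degree \<open>b\<close>, only the
  summand with index \<open>k\<close> survives in degree \<open>b + k\<close>.\<close>

lemma conv_homog_rep:
  assumes "FB.rep q" "v \<in> FM b"
  shows "conv q (FM.homog_rep b v) (b + k) = q k \<odot>\<^bsub>M\<^esub> v"
proof -
  have c: "\<And>i. q i \<in> carrier B" "v \<in> carrier M"
    using assms FB.rep_carrier FM.step_carrier by auto
  have "conv q (FM.homog_rep b v) (b + k)
      = (\<Oplus>\<^bsub>M\<^esub>i \<in> {..b + k}. if k = i then q i \<odot>\<^bsub>M\<^esub> v else \<zero>\<^bsub>M\<^esub>)"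
    unfolding conv_def by (rule M.finsum_cong') (auto simp: c r_null FM.homog_rep_def)
  also have "\<dots> = q k \<odot>\<^bsub>M\<^esub> v"
    by (rule M.finsum_singleton) (auto simp: c)
  finally show ?thesis .
qed

text \<open>Only \<open>u \<in> FM (b + k)\<close> is assumed, not that the degree is exact, so that
  an induction on \<open>k\<close> also covers degree drops of more than one.\<close>

lemma leading_term_division:
  assumes E: "euclidean_module (gr_ring B FB) (gr_module M FM) (graded_deg (gr_module M FM))"
    and v: "v \<in> FM b" "v \<notin> pred_step M FM b" and u: "u \<in> FM (b + k)"
  shows "\<exists>q \<in> FB k. u \<ominus>\<^bsub>M\<^esub> q \<odot>\<^bsub>M\<^esub> v \<in> pred_step M FM (b + k)"
proof (cases "u \<in> pred_step M FM (b + k)")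
  \<comment> \<open>The class of \<open>u\<close> in degree \<open>b + k\<close> vanishes, so graded
    division does not apply to it; \<open>q = 0\<close> suffices.\<close>
  case True
  then show ?thesis
    using v u FM.step_carrier by (intro bexI[of _ "\<zero>\<^bsub>B\<^esub>"]) (auto simp: l_null M.minus_eq a_inv_def)
next
  case False
  define hu hv where "hu = FM.homog_rep (b + k) u" and "hv = FM.homog_rep b v"
  have rep: "FM.rep hu" "FM.rep hv" using u v(1) by (auto simp: hu_def hv_def FM.rep_homog_rep)
  have "FM.cls hu \<in> carrier (gr_module M FM) - {\<zero>\<^bsub>gr_module M FM\<^esub>}"
    "FM.cls hv \<in> carrier (gr_module M FM) - {\<zero>\<^bsub>gr_module M FM\<^esub>}"
    using homog_nonzero[OF u False] homog_nonzero[OF v] rep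
    by (auto simp: gr_module_carrier hu_def hv_def)
  then obtain Q R where Q: "Q \<in> carrier (gr_ring B FB)" and R: "R \<in> carrier (gr_module M FM)"
    and QR: "FM.cls hu = Q \<odot>\<^bsub>gr_module M FM\<^esub> FM.cls hv \<oplus>\<^bsub>gr_module M FM\<^esub> R"
    and d: "R = \<zero>\<^bsub>gr_module M FM\<^esub> \<or>
      graded_deg (gr_module M FM) R < graded_deg (gr_module M FM) (FM.cls hv)"
    using E unfolding euclidean_module_def by blast
  obtain q r where q: "FB.rep q" "Q = FB.cls q" and r: "FM.rep r" "R = FM.cls r"
    using Q R by (auto simp: FB.gr_ring_carrier gr_module_carrier)
  have "graded_deg (gr_module M FM) (FM.cls hv) = b"
    using graded_deg_homog[OF v] by (simp add: hv_def)
  \<comment> \<open>The graded remainder is zero or has degree below \<open>b\<close>, hence has no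
    component in degree \<open>b + k\<close>.\<close>
  then have rp: "r (b + k) \<in> pred_step M FM (b + k)"
    using d r above_graded_deg[OF r(1), of "b + k"] cls_zero_iff[OF r(1)] by auto
  have c: "u \<in> carrier M" "v \<in> carrier M" "q k \<in> carrier B" "r (b + k) \<in> carrier M"
    using u v q r FM.step_carrier FB.rep_carrier FM.rep_carrier by auto
  have "FM.cls hu = FM.cls (\<lambda>i. conv q hv i \<oplus>\<^bsub>M\<^esub> r i)"
    using QR q r rep by (simp add: gr_module_smult gr_module_add rep_conv)
  then have "hu (b + k) \<ominus>\<^bsub>M\<^esub> (conv q hv (b + k) \<oplus>\<^bsub>M\<^esub> r (b + k)) \<in> pred_step M FM (b + k)"
    using rep q r by (subst (asm) FM.cls_eq_iff) (auto simp: FM.rep_add rep_conv)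
  then have "u \<ominus>\<^bsub>M\<^esub> (q k \<odot>\<^bsub>M\<^esub> v \<oplus>\<^bsub>M\<^esub> r (b + k)) \<in> pred_step M FM (b + k)"
    using conv_homog_rep[OF q(1) v(1)] by (simp add: hu_def hv_def FM.homog_rep_def[of "b + k"])
  \<comment> \<open>Adding \<open>r (b + k)\<close> back cancels the remainder without leaving the
    preceding step.\<close>
  from FM.pred_add[OF this rp] have "u \<ominus>\<^bsub>M\<^esub> q k \<odot>\<^bsub>M\<^esub> v \<in> pred_step M FM (b + k)"
    using c by (simp add: M.minus_eq M.minus_add M.a_assoc M.l_neg)
  then show ?thesis using q(1) by (auto simp: FB.rep_def)
qed

text \<open>Induction on \<open>k\<close> peels off one leading term at a time. The bound on
  \<open>q\<close> is carried along for the later computation of its degree; at \<open>k = 0\<close>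
  it forces \<open>q = 0\<close>, and \<open>u\<close> is itself the remainder.\<close>

lemma filtered_division:
  assumes E: "euclidean_module (gr_ring B FB) (gr_module M FM) (graded_deg (gr_module M FM))"
    and v: "v \<in> FM b" "v \<notin> pred_step M FM b"
  shows "u \<in> pred_step M FM (b + k) \<Longrightarrow>
    \<exists>q \<in> pred_step B FB k. \<exists>r \<in> pred_step M FM b. u = q \<odot>\<^bsub>M\<^esub> v \<oplus>\<^bsub>M\<^esub> r"
proof (induction k arbitrary: u)
  case 0
  then show ?case
    using v FM.step_carrier FM.pred_carrier
    by (intro bexI[of _ "\<zero>\<^bsub>B\<^esub>"] bexI[of _ u]) (auto simp: l_null)
next
  case (Suc k)
  then have u: "u \<in> FM (b + k)" by (simp add: pred_step_def)
  obtain p where p: "p \<in> FB k" and up: "u \<ominus>\<^bsub>M\<^esub> p \<odot>\<^bsub>M\<^esub> v \<in> pred_step M FM (b + k)"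
    using leading_term_division[OF E v u] by blast
  obtain q r where q: "q \<in> pred_step B FB k" and r: "r \<in> pred_step M FM b"
    and eq: "u \<ominus>\<^bsub>M\<^esub> p \<odot>\<^bsub>M\<^esub> v = q \<odot>\<^bsub>M\<^esub> v \<oplus>\<^bsub>M\<^esub> r"
    using Suc.IH[OF up] by blast
  have c: "u \<in> carrier M" "v \<in> carrier M" "p \<in> carrier B" "q \<in> carrier B" "r \<in> carrier M"
    using u v p q r FM.step_carrier FB.step_carrier FB.pred_carrier FM.pred_carrier by auto
  have "u = p \<odot>\<^bsub>M\<^esub> v \<oplus>\<^bsub>M\<^esub> (u \<ominus>\<^bsub>M\<^esub> p \<odot>\<^bsub>M\<^esub> v)"
    using c by (simp add: M.minus_eq M.a_ac M.r_neg1 M.r_neg)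
  also have "\<dots> = (p \<oplus>\<^bsub>B\<^esub> q) \<odot>\<^bsub>M\<^esub> v \<oplus>\<^bsub>M\<^esub> r"
    using c unfolding eq by (simp add: smult_l_distr M.a_assoc)
  finally have "u = (p \<oplus>\<^bsub>B\<^esub> q) \<odot>\<^bsub>M\<^esub> v \<oplus>\<^bsub>M\<^esub> r" .
  \<comment> \<open>Both summands lie in \<open>FB k\<close>, which is the step preceding
    \<open>Suc k\<close>.\<close>
  moreover have "p \<oplus>\<^bsub>B\<^esub> q \<in> pred_step B FB (Suc k)"
    using p subsetD[OF FB.pred_step_subset q] additive_subgroup.a_closed[OF FB.step_subgroup]
    by (auto simp: pred_step_def[of B FB "Suc k"])
  ultimately show ?case using r by blast
qed

text \<open>\<open>filtered_division\<close> bounds the degree of \<open>q\<close> from above; the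
  exact degree of \<open>u\<close> bounds it from below.\<close>

lemma division_by_degree:
  assumes E: "euclidean_module (gr_ring B FB) (gr_module M FM) (graded_deg (gr_module M FM))"
    and u: "u \<in> carrier M" "u \<noteq> \<zero>\<^bsub>M\<^esub>" and v: "v \<in> carrier M" "v \<noteq> \<zero>\<^bsub>M\<^esub>"
    and le: "filt_deg M FM v \<le> filt_deg M FM u"
  shows "\<exists>q \<in> carrier B. \<exists>r \<in> carrier M.
    u = q \<odot>\<^bsub>M\<^esub> v \<oplus>\<^bsub>M\<^esub> r \<and>
    q \<noteq> \<zero>\<^bsub>B\<^esub> \<and> filt_deg B FB q = filt_deg M FM u - filt_deg M FM v \<and>
    (r = \<zero>\<^bsub>M\<^esub> \<or> filt_deg M FM r < filt_deg M FM v)"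
proof -
  define b k where "b = filt_deg M FM v" and "k = filt_deg M FM u - filt_deg M FM v"
  have du: "filt_deg M FM u = b + k" using le by (simp add: b_def k_def)
  have uF: "u \<in> FM (b + k)" "u \<notin> pred_step M FM (b + k)"
    using FM.filt_deg_mem[OF u] du by auto
  have vF: "v \<in> FM b" "v \<notin> pred_step M FM b"
    using FM.filt_deg_mem[OF v] by (auto simp: b_def)
  \<comment> \<open>The shift to \<open>Suc k\<close> turns the bounds by preceding steps into
    \<open>u \<in> FM (b + k)\<close> and \<open>q \<in> FB k\<close>.\<close>
  have "u \<in> pred_step M FM (b + Suc k)" using uF by (simp add: pred_step_def)
  then obtain q r where q: "q \<in> pred_step B FB (Suc k)" and r: "r \<in> pred_step M FM b"
    and eq: "u = q \<odot>\<^bsub>M\<^esub> v \<oplus>\<^bsub>M\<^esub> r"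
    using filtered_division[OF E vF, of u "Suc k"] by blast
  have qk: "q \<in> FB k" using q by (simp add: pred_step_def)
  \<comment> \<open>Otherwise \<open>qv\<close> and \<open>r\<close> both lie in the step preceding
    \<open>b + k\<close>, and so would \<open>u\<close>.\<close>
  have qn: "q \<notin> pred_step B FB k"
  proof
    assume "q \<in> pred_step B FB k"
    then have "q \<odot>\<^bsub>M\<^esub> v \<in> pred_step M FM (b + k)"
      using pred_smult[of q k v b] qk vF by (simp add: add.commute)
    then show False
      using uF(2) eq FM.pred_add r FM.pred_mono[of b "b + k"] by auto
  qed
  have "q \<in> carrier B" "r \<in> carrier M" using qk r FB.step_carrier FM.pred_carrier by auto
  moreover have "q \<noteq> \<zero>\<^bsub>B\<^esub>" using qn by auto
  moreover have "filt_deg B FB q = k" using qk qn by (rule FB.filt_deg_eq)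
  moreover have "r = \<zero>\<^bsub>M\<^esub> \<or> filt_deg M FM r < b"
    using r FM.pred_iff_filt_deg FM.pred_carrier by blast
  ultimately show ?thesis using eq unfolding b_def k_def by blast
qed

theorem euclidean_filtered_module:
  assumes E: "euclidean_module (gr_ring B FB) (gr_module M FM) (graded_deg (gr_module M FM))"
  shows "euclidean_module B M (filt_deg M FM)"
  unfolding euclidean_module_def
proof (intro conjI ballI left_module_axioms)
  fix u v assume "u \<in> carrier M - {\<zero>\<^bsub>M\<^esub>}" "v \<in> carrier M - {\<zero>\<^bsub>M\<^esub>}"
  then have u: "u \<in> carrier M" "u \<noteq> \<zero>\<^bsub>M\<^esub>" and v: "v \<in> carrier M" "v \<noteq> \<zero>\<^bsub>M\<^esub>" by auto
  show "\<exists>q \<in> carrier B. \<exists>r \<in> carrier M. u = q \<odot>\<^bsub>M\<^esub> v \<oplus>\<^bsub>M\<^esub> r \<and>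
      (r = \<zero>\<^bsub>M\<^esub> \<or> filt_deg M FM r < filt_deg M FM v)"
  proof (cases "filt_deg M FM v \<le> filt_deg M FM u")
    case True
    then show ?thesis using division_by_degree[OF E u v] by blast
  next
    \<comment> \<open>Here \<open>u\<close> has smaller degree than \<open>v\<close>, so
      \<open>q = 0\<close> and \<open>r = u\<close> work.\<close>
    case False
    then show ?thesis
      using u v by (intro bexI[of _ "\<zero>\<^bsub>B\<^esub>"] bexI[of _ u]) (auto simp: l_null)
  qed
qed

section \<open>The graded submodule of a submodule\<close>

text \<open>Representatives of all components can be chosen in \<open>N\<close> at once, which makes
  the calculus of \<open>rep\<close>, \<open>cls\<close> and \<open>conv\<close> available for
  gr(\<open>N\<close>).\<close>

lemma gr_submodule_cls:
  "gr_submodule M FM N = FM.cls ` {a. FM.rep a \<and> (\<forall>i. a i \<in> N)}"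
proof (intro equalityI subsetI)
  fix f assume "f \<in> gr_submodule M FM N"
  then have "\<forall>i. \<exists>x. x \<in> N \<inter> FM i \<and> f i = pred_step M FM i +>\<^bsub>M\<^esub> x"
    and f: "f \<in> carrier (gr_module M FM)"
    unfolding gr_submodule_def by blast+
  then obtain a where a: "\<And>i. a i \<in> N \<inter> FM i" "\<And>i. f i = pred_step M FM i +>\<^bsub>M\<^esub> a i"
    by metis
  obtain c where c: "FM.rep c" "f = FM.cls c" using f by (auto simp: gr_module_carrier)
  have eq: "f = FM.cls a" using a by (auto simp: FM.cls_def)
  \<comment> \<open>The choice of \<open>a\<close> says nothing about finite support. It is
    inherited from \<open>c\<close>, since both sequences represent \<open>f\<close>.\<close>
  have "a i \<in> pred_step M FM i \<longleftrightarrow> c i \<in> pred_step M FM i" for i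
    using a[of i] c FM.coset_pred[of "a i" i] FM.coset_pred[of "c i" i] FM.step_carrier
      FM.rep_carrier[OF c(1)] by (auto simp: FM.cls_def)
  then have "FM.rep a" using a c(1) by (auto simp: FM.rep_def)
  then show "f \<in> FM.cls ` {a. FM.rep a \<and> (\<forall>i. a i \<in> N)}" using eq a by blast
next
  fix f assume "f \<in> FM.cls ` {a. FM.rep a \<and> (\<forall>i. a i \<in> N)}"
  then show "f \<in> gr_submodule M FM N"
    by (auto simp: gr_submodule_def gr_module_carrier FM.rep_def FM.cls_def)
qed

lemma submodule_gr_submodule:
  assumes N: "submodule N B M"
  shows "submodule (gr_submodule M FM N) (gr_ring B FB) (gr_module M FM)"
proof -
  interpret G: left_module "gr_ring B FB" "gr_module M FM" by (rule gr_module_is_module)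
  show ?thesis
  proof (rule G.submoduleI)
    show "gr_submodule M FM N \<subseteq> carrier (gr_module M FM)" by (auto simp: gr_submodule_def)
    show "\<zero>\<^bsub>gr_module M FM\<^esub> \<in> gr_submodule M FM N"
      using submodule_zero[OF N] FM.rep_zero
      by (auto simp: gr_submodule_cls gr_module_def FM.gr_zero)
  next
    fix x y assume "x \<in> gr_submodule M FM N" "y \<in> gr_submodule M FM N"
    then show "x \<oplus>\<^bsub>gr_module M FM\<^esub> y \<in> gr_submodule M FM N"
      by (auto simp: gr_submodule_cls gr_module_add FM.rep_add submodule_add[OF N])
  next
    fix c x assume c: "c \<in> carrier (gr_ring B FB)" and x: "x \<in> gr_submodule M FM N"
    obtain q a where q: "FB.rep q" "c = FB.cls q"
      and a: "FM.rep a" "\<And>i. a i \<in> N" "x = FM.cls a"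
      using c x by (auto simp: gr_submodule_cls FB.gr_ring_carrier)
    \<comment> \<open>Each component of the product is represented by a finite sum of ring multiples
      of elements of \<open>N\<close>.\<close>
    have "conv q a i \<in> N" for i
      unfolding conv_def
      by (rule submodule_finsum[OF N]) (auto simp: a submodule.smult_closed[OF N] FB.rep_carrier[OF q(1)])
    then show "c \<odot>\<^bsub>gr_module M FM\<^esub> x \<in> gr_submodule M FM N"
      using q a by (auto simp: gr_submodule_cls gr_module_smult rep_conv)
  qed
qed

section \<open>Minimal degrees and leading terms\<close>

lemma gr_elt_gr_submodule:
  assumes N: "submodule N B M" and x: "x \<in> N" "x \<noteq> \<zero>\<^bsub>M\<^esub>"
  shows "gr_elt M FM x \<in> gr_submodule M FM N" "gr_elt M FM x \<noteq> \<zero>\<^bsub>gr_module M FM\<^esub>"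
    "graded_deg (gr_module M FM) (gr_elt M FM x) = filt_deg M FM x"
proof -
  have c: "x \<in> carrier M" using x submodule_subset[OF N] by blast
  have F: "x \<in> FM (filt_deg M FM x)" "x \<notin> pred_step M FM (filt_deg M FM x)"
    using FM.filt_deg_mem[OF c x(2)] .
  have eq: "gr_elt M FM x = FM.cls (FM.homog_rep (filt_deg M FM x) x)"
    by (simp add: gr_elt_def FM.gr_homog_eq_cls)
  show "gr_elt M FM x \<in> gr_submodule M FM N"
    using FM.rep_homog_rep[OF F(1)] x submodule_zero[OF N] unfolding eq gr_submodule_cls
    by (auto simp: FM.homog_rep_def)
  show "gr_elt M FM x \<noteq> \<zero>\<^bsub>gr_module M FM\<^esub>" "graded_deg (gr_module M FM) (gr_elt M FM x) = filt_deg M FM x"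
    using homog_nonzero[OF F] graded_deg_homog[OF F] by (simp_all add: eq)
qed

text \<open>Not only the minima but the whole sets of degrees agree: leading terms preserve degree,
  and the top component of an element of gr(\<open>N\<close>) has a representative in
  \<open>N\<close> of the same degree.\<close>

lemma min_deg_gr_submodule:
  assumes N: "submodule N B M"
  shows "min_deg M (filt_deg M FM) N =
    min_deg (gr_module M FM) (graded_deg (gr_module M FM)) (gr_submodule M FM N)"
proof -
  have "(\<exists>x \<in> N. x \<noteq> \<zero>\<^bsub>M\<^esub> \<and> k = filt_deg M FM x) \<longleftrightarrow>
    (\<exists>f \<in> gr_submodule M FM N. f \<noteq> \<zero>\<^bsub>gr_module M FM\<^esub> \<and> k = graded_deg (gr_module M FM) f)" for k
  proof
    assume "\<exists>x \<in> N. x \<noteq> \<zero>\<^bsub>M\<^esub> \<and> k = filt_deg M FM x"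
    then show "\<exists>f \<in> gr_submodule M FM N. f \<noteq> \<zero>\<^bsub>gr_module M FM\<^esub> \<and> k = graded_deg (gr_module M FM) f"
      using gr_elt_gr_submodule[OF N] by metis
  next
    assume "\<exists>f \<in> gr_submodule M FM N. f \<noteq> \<zero>\<^bsub>gr_module M FM\<^esub> \<and> k = graded_deg (gr_module M FM) f"
    then obtain a where "FM.rep a" "\<And>i. a i \<in> N" "FM.cls a \<noteq> \<zero>\<^bsub>gr_module M FM\<^esub>"
      "k = graded_deg (gr_module M FM) (FM.cls a)"
      by (auto simp: gr_submodule_cls)
    then show "\<exists>x \<in> N. x \<noteq> \<zero>\<^bsub>M\<^esub> \<and> k = filt_deg M FM x"
      using FM.rep_component_deg[of a k] graded_deg_attained[of a] by metis
  qed
  then show ?thesis by (simp add: min_deg_def)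
qed

text \<open>A nonzero component below the top one would lift to an element of \<open>N\<close> of degree smaller
  than the minimum.\<close>

lemma min_deg_elts_homogeneous:
  assumes N: "submodule N B M"
    and f: "f \<in> min_deg_elts (gr_module M FM) (graded_deg (gr_module M FM)) (gr_submodule M FM N)"
  obtains x where "x \<in> min_deg_elts M (filt_deg M FM) N" "f = gr_elt M FM x"
proof -
  let ?l = "min_deg M (filt_deg M FM) N"
  obtain a where a: "FM.rep a" "\<And>i. a i \<in> N" "f = FM.cls a"
    and nz: "FM.cls a \<noteq> \<zero>\<^bsub>gr_module M FM\<^esub>"
    and d: "graded_deg (gr_module M FM) (FM.cls a) = ?l"
    using f by (auto simp: min_deg_elts_def gr_submodule_cls min_deg_gr_submodule[OF N])
  note lift = FM.rep_component_deg[OF a(1)]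
  have top: "a ?l \<notin> pred_step M FM ?l" using graded_deg_attained[OF a(1) nz] by (simp add: d)
  have below: "a i \<in> pred_step M FM i" if "i \<noteq> ?l" for i
  proof (rule ccontr)
    assume i: "a i \<notin> pred_step M FM i"
    then have "?l \<le> i" using lift[OF i] min_deg_le[of "a i" N M "filt_deg M FM"] a(2) by auto
    then show False using i above_graded_deg[OF a(1), of i] that d by auto
  qed
  have "a ?l \<in> min_deg_elts M (filt_deg M FM) N"
    using lift[OF top] a(2) by (simp add: min_deg_elts_def)
  moreover have "f = gr_elt M FM (a ?l)"
    using below lift(2)[OF top] a FM.rep_carrier[OF a(1)]
    by (auto simp: fun_eq_iff gr_elt_def gr_homog_def FM.cls_def FM.coset_pred)
  ultimately show thesis by (rule that)
qed

lemma gr_elt_min_deg_elts: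
  assumes N: "submodule N B M"
  shows "gr_elt M FM ` min_deg_elts M (filt_deg M FM) N =
    min_deg_elts (gr_module M FM) (graded_deg (gr_module M FM)) (gr_submodule M FM N)"
proof (intro equalityI subsetI)
  fix f assume "f \<in> gr_elt M FM ` min_deg_elts M (filt_deg M FM) N"
  then show "f \<in> min_deg_elts (gr_module M FM) (graded_deg (gr_module M FM)) (gr_submodule M FM N)"
    using gr_elt_gr_submodule[OF N]
    by (auto simp: min_deg_elts_def min_deg_gr_submodule[OF N])
qed (blast elim: min_deg_elts_homogeneous[OF N])

section \<open>Uni-annihilators\<close>

lemma component_gr_elt:
  "component (gr_module M FM) (gr_elt M FM x) i =
    (if i = filt_deg M FM x then gr_elt M FM x else \<zero>\<^bsub>gr_module M FM\<^esub>)"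
  by (auto simp: fun_eq_iff component_def gr_elt_def gr_homog_def gr_module_zero)

text \<open>A leading term is homogeneous, so its only nonzero component is itself and the
  annihilators to be compared are those of one element.\<close>

lemma gr_elt_uni_annihilator:
  assumes N: "submodule N B M" and x: "x \<in> N" "x \<noteq> \<zero>\<^bsub>M\<^esub>"
  shows "gr_elt M FM x \<in>
    uni_annihilators (gr_ring B FB) ((gr_module M FM)\<lparr>carrier := gr_submodule M FM N\<rparr>)"
proof -
  \<comment> \<open>\<open>component\<close> consults only the zero of the record, which the change
    of carrier leaves alone.\<close>
  have "component ((gr_module M FM)\<lparr>carrier := gr_submodule M FM N\<rparr>) f i =
      component (gr_module M FM) f i" for f i
    by (rule ext) (simp add: component_def)
  then show ?thesis
    using gr_elt_gr_submodule(1)[OF assms] by (simp add: uni_annihilators_def component_gr_elt)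
qed

end

theorem proposition3p9:
  fixes B :: "('a, 'r) ring_scheme" and FB :: "nat \<Rightarrow> 'a set"
    and M :: "('a, 'b, 'm) module_scheme" and FM :: "nat \<Rightarrow> 'b set"
  assumes "filtered_ring B FB"
    and "filtered_module B FB M FM"
    and "euclidean_module (gr_ring B FB) (gr_module M FM) (graded_deg (gr_module M FM))"
  shows
    "(euclidean_module B M (filt_deg M FM) \<and>
      (\<forall>u \<in> carrier M - {\<zero>\<^bsub>M\<^esub>}. \<forall>v \<in> carrier M - {\<zero>\<^bsub>M\<^esub>}.
        filt_deg M FM u \<ge> filt_deg M FM v \<longrightarrow>
        (\<exists>q \<in> carrier B. \<exists>r \<in> carrier M.
          u = q \<odot>\<^bsub>M\<^esub> v \<oplus>\<^bsub>M\<^esub> r \<and>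
          q \<noteq> \<zero>\<^bsub>B\<^esub> \<and> filt_deg B FB q = filt_deg M FM u - filt_deg M FM v \<and>
          (r = \<zero>\<^bsub>M\<^esub> \<or> filt_deg M FM r < filt_deg M FM v)))) \<and>
     (\<forall>N. submodule N B M \<longrightarrow> (\<exists>n \<in> N. N = cyclic_submodule B M n)) \<and>
     (\<forall>N. submodule N B M \<and> N \<noteq> {\<zero>\<^bsub>M\<^esub>} \<longrightarrow>
       (let grN = gr_submodule M FM N;
            GN = min_deg_elts M (filt_deg M FM) N;
            GgrN = min_deg_elts (gr_module M FM) (graded_deg (gr_module M FM)) grN
        in GN \<noteq> {} \<and> (\<forall>n \<in> GN. N = cyclic_submodule B M n) \<and>
           GgrN \<noteq> {} \<and> (\<forall>\<nu> \<in> GgrN. grN = cyclic_submodule (gr_ring B FB) (gr_module M FM) \<nu>) \<and>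
           min_deg M (filt_deg M FM) N =
             min_deg (gr_module M FM) (graded_deg (gr_module M FM)) grN \<and>
           gr_elt M FM ` GN = GgrN \<and>
           GgrN \<subseteq> uni_annihilators (gr_ring B FB) ((gr_module M FM)\<lparr>carrier := grN\<rparr>)))"
proof -
  interpret filtered_module B FB M FM by (rule assms(2))
  let ?G = "gr_module M FM"
  note E = assms(3)
  have EM: "euclidean_module B M (filt_deg M FM)" by (rule euclidean_filtered_module[OF E])
  have nonempty: "min_deg_elts M (filt_deg M FM) N \<noteq> {}"
    if "submodule N B M" "N \<noteq> {\<zero>\<^bsub>M\<^esub>}" for N
    using submodule_zero[OF that(1)] that(2) by (rule min_deg_elts_nonempty)
  have "\<exists>n \<in> N. N = cyclic_submodule B M n" if N: "submodule N B M" for N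
  proof (cases "N = {\<zero>\<^bsub>M\<^esub>}")
    \<comment> \<open>The zero submodule has no element of minimal degree; it is generated by
      zero.\<close>
    case True
    then show ?thesis by (auto simp: cyclic_submodule_def r_null)
  next
    case False
    then obtain n where n: "n \<in> min_deg_elts M (filt_deg M FM) N"
      using nonempty[OF N] by blast
    then show ?thesis
      using euclidean_module_generator[OF EM N n] by (auto simp: min_deg_elts_def)
  qed
  moreover have "min_deg_elts ?G (graded_deg ?G) (gr_submodule M FM N) \<subseteq>
      uni_annihilators (gr_ring B FB) (?G\<lparr>carrier := gr_submodule M FM N\<rparr>)"
    if N: "submodule N B M" for N
    unfolding gr_elt_min_deg_elts[OF N, symmetric]
    using gr_elt_uni_annihilator[OF N] by (auto simp: min_deg_elts_def)
  \<comment> \<open>This set is the image under \<open>gr_elt\<close> of the corresponding nonempty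
    set for \<open>N\<close>.\<close>
  moreover have "min_deg_elts ?G (graded_deg ?G) (gr_submodule M FM N) \<noteq> {}"
    if N: "submodule N B M" "N \<noteq> {\<zero>\<^bsub>M\<^esub>}" for N
    using nonempty[OF N] gr_elt_min_deg_elts[OF N(1)] by blast
  ultimately show ?thesis
    unfolding Let_def
    using EM division_by_degree[OF E] nonempty
      euclidean_module_generator[OF EM]
      euclidean_module_generator[OF E submodule_gr_submodule]
      min_deg_gr_submodule gr_elt_min_deg_elts
    by (intro conjI allI ballI impI; (elim conjE DiffE)?) simp_all
qed

end
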